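(* Let $X$ be a Banach space with topological dual $X^*$. Let $K,U$ be nonempty convex subsets of $X$ such that $K\cap\mathrm{cor}\,U$ is nonempty and weakly compact. Let $T:X\rightrightarrows X^*$ be a set-valued map that is quasimonotone on $K$. If $T$ is locally upper sign-continuous, then there exists $\bar x\in K$ such that $$\sup_{x^*\in T(\bar x)}\langle x^*,y-\bar x\rangle\ge 0\qquad\text{for all } y\in K.$$
   Context: $X$ is a (real) Banach space, $X^*$ its topological dual, $\langle\cdot,\cdot\rangle$ the duality pairing. Conventions: $\inf\emptyset=+\infty$, $\sup\emptyset=-\infty$. The algebraic interior of $U\subset X$ is $\mathrm{cor}\,U=\{y\in U:\ \forall x\in X\ \exists\lambda>0\ \forall t\in[0,\lambda),\ y+tx\in U\}$. $T$ is quasimonotone on $K$ if for all $x,y\in K$: if there is $x^*\in T(x)$ with $\langle x^*,y-x\rangle>0$, then $\langle y^*,y-x\rangle\ge 0$ for all $y^*\in T(y)$. A set-valued map $\Phi$ with values in subsets of $X^*$ is upper sign-continuous on a convex set $C$ if for all $x,y\in C$, with $x_t=tx+(1-t)y$: whenever $\inf_{x_t^*\in\Phi(x_t)}\langle x_t^*,y-x\rangle\ge 0$ for all $t\in(0,1)$, one has $\sup_{x^*\in\Phi(x)}\langle x^*,y-x\rangle\ge 0$. $T:X\rightrightarrows X^*$ is locally upper sign-continuous at $x$ if there exist a convex neighbourhood $V$ of $x$ and a map $\Phi_x:V\rightrightarrows X^*$, upper sign-continuous (on $V$), with nonempty convex $w^*$-compact values, such that $\Phi_x(v)\subset T(v)\setminus\{0\}$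 for every $v\in V$. It is locally upper sign-continuous if this holds at every point $x\in X$. *)

theory Defs
  imports "HOL-Analysis.Analysis"
begin

text \<open>
  The topological dual of \<open>X = 'a\<close> is \<open>'a \<Rightarrow>\<^sub>L real\<close>; a set-valued map \<open>X \<rightrightarrows> X*\<close> is a
  function \<open>'a \<Rightarrow> ('a \<Rightarrow>\<^sub>L real) set\<close> whose values may be empty. Suprema and infima of
  \<open>\<langle>x*, z\<rangle>\<close> are taken in \<open>ereal\<close>, so that \<open>inf {} = \<infinity>\<close> and \<open>sup {} = -\<infinity>\<close>.
\<close>

text \<open>The euclidean topology on the function space \<open>('a \<Rightarrow>\<^sub>L real) \<Rightarrow> real\<close> is the topology of
  pointwise convergence, so this is the initial topology of the family of all continuous linear
  functionals.\<close>

definition weak_topology :: "'a::real_normed_vector topology" where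
  "weak_topology =
     pullback_topology UNIV (\<lambda>x (f :: 'a \<Rightarrow>\<^sub>L real). blinfun_apply f x) euclidean"

text \<open>For real-valued operators the strong operator topology, i.e. pointwise convergence on
  \<open>'a\<close>, is the weak-star topology of the dual.\<close>

definition weak_star_topology :: "('a::real_normed_vector \<Rightarrow>\<^sub>L real) topology" where
  "weak_star_topology = strong_operator_topology"

definition algebraic_interior :: "'a::real_vector set \<Rightarrow> 'a set" where
  "algebraic_interior U =
     {y \<in> U. \<forall>x. \<exists>l>0. \<forall>t::real. 0 \<le> t \<and> t < l \<longrightarrow> y + t *\<^sub>R x \<in> U}"

definition quasimonotone_on ::
    "'a::real_normed_vector set \<Rightarrow> ('a \<Rightarrow> ('a \<Rightarrow>\<^sub>L real) set) \<Rightarrow> bool" where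
  "quasimonotone_on K T \<longleftrightarrow>
     (\<forall>x\<in>K. \<forall>y\<in>K. (\<exists>xs\<in>T x. blinfun_apply xs (y - x) > 0) \<longrightarrow>
        (\<forall>ys\<in>T y. blinfun_apply ys (y - x) \<ge> 0))"

text \<open>Only used for convex \<open>C\<close>; the values of \<open>\<Phi>\<close> outside \<open>C\<close> are then irrelevant.\<close>

definition upper_sign_continuous_on ::
    "'a::real_normed_vector set \<Rightarrow> ('a \<Rightarrow> ('a \<Rightarrow>\<^sub>L real) set) \<Rightarrow> bool" where
  "upper_sign_continuous_on C \<Phi> \<longleftrightarrow>
     (\<forall>x\<in>C. \<forall>y\<in>C.
        (\<forall>t::real. 0 < t \<and> t < 1 \<longrightarrow>
           (INF xs \<in> \<Phi> (t *\<^sub>R x + (1 - t) *\<^sub>R y). ereal (blinfun_apply xs (y - x))) \<ge> 0) \<longrightarrow>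
        (SUP xs \<in> \<Phi> x. ereal (blinfun_apply xs (y - x))) \<ge> 0)"

definition locally_upper_sign_continuous_at ::
    "('a::real_normed_vector \<Rightarrow> ('a \<Rightarrow>\<^sub>L real) set) \<Rightarrow> 'a \<Rightarrow> bool" where
  "locally_upper_sign_continuous_at T x \<longleftrightarrow>
     (\<exists>V \<Phi>. convex V \<and> x \<in> interior V \<and> upper_sign_continuous_on V \<Phi> \<and>
        (\<forall>v\<in>V. \<Phi> v \<noteq> {} \<and> convex (\<Phi> v) \<and> compactin weak_star_topology (\<Phi> v) \<and>
           \<Phi> v \<subseteq> T v - {0}))"

definition locally_upper_sign_continuous ::
    "('a::real_normed_vector \<Rightarrow> ('a \<Rightarrow>\<^sub>L real) set) \<Rightarrow> bool" where
  "locally_upper_sign_continuous T \<longleftrightarrow> (\<forall>x. locally_upper_sign_continuous_at T x)"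

end

theory Submission
  imports Defs
begin

text \<open>
  Put \<open>C = K \<inter> cor U\<close>. Suppose first that \<open>T\<close> is properly quasimonotone on \<open>C\<close>: for every finite
  family of pairs \<open>(x\<^sub>i, x\<^sub>i*)\<close> in the graph of \<open>T\<close> over \<open>C\<close> and every \<open>z\<close> in the hull of the
  \<open>x\<^sub>i\<close>, some \<open>\<langle>x\<^sub>i*, x\<^sub>i - z\<rangle>\<close> is nonnegative. A KKM argument and weak compactness then give a
  solution \<open>x \<in> C\<close> of the Minty inequality on \<open>C\<close>, and \<open>C\<close> contains an initial piece of every
  segment from \<open>x\<close> to a point of \<open>K\<close>. Otherwise some \<open>z\<close> in such a hull violates all the
  inequalities strictly; the violation persists along initial pieces of segments from \<open>z\<close>, so
  that quasimonotonicity makes \<open>z\<close> a local Minty solution. In both cases upper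
  sign-continuity, applied along a short segment, turns the local Minty inequality into the
  claim.
\<close>

section \<open>A finite KKM principle for concave functions\<close>

lemma continuous_on_Min_image:
  fixes f :: "'i \<Rightarrow> 'a::topological_space \<Rightarrow> real"
  assumes "finite I" "I \<noteq> {}" "\<And>i. i \<in> I \<Longrightarrow> continuous_on S (f i)"
  shows "continuous_on S (\<lambda>z. Min ((\<lambda>i. f i z) ` I))"
  using assms by (induction I rule: finite_ne_induct) (auto intro!: continuous_on_min)

text \<open>Concavity makes the superlevel sets convex, which allows a proof of this KKM principle
  without Brouwer's fixed point theorem.\<close>

lemma concave_KKM:
  fixes f :: "'i \<Rightarrow> 'a::real_normed_vector \<Rightarrow> real" and x :: "'i \<Rightarrow> 'a"
  assumes "finite I" "I \<noteq> {}"
    and "\<And>i. i \<in> I \<Longrightarrow> concave_on UNIV (f i)"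
    and "\<And>i. i \<in> I \<Longrightarrow> continuous_on UNIV (f i)"
    and "\<And>J z. J \<subseteq> I \<Longrightarrow> J \<noteq> {} \<Longrightarrow> z \<in> convex hull (x ` J) \<Longrightarrow> \<exists>i\<in>J. f i z \<ge> 0"
  shows "\<exists>z \<in> convex hull (x ` I). \<forall>i\<in>I. f i z \<ge> 0"
  using assms
proof (induction I rule: finite_psubset_induct)
  case (psubset I)
  note conc = psubset.prems(2) and cont = psubset.prems(3) and cover = psubset.prems(4)
  let ?S = "convex hull (x ` I)"
  \<comment> \<open>The induction hypothesis drops one index: the point \<open>y j\<close> obtained
    below satisfies every inequality except possibly that of \<open>j\<close>.\<close>
  have "\<exists>y\<in>?S. \<forall>i\<in>I - {j}. f i y \<ge> 0" if j: "j \<in> I" for j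
  proof (cases "I = {j}")
    case True
    then show ?thesis by simp
  next
    case False
    have "\<exists>y\<in>convex hull (x ` (I - {j})). \<forall>i\<in>I - {j}. f i y \<ge> 0"
    proof (rule psubset.IH)
      show "I - {j} \<subset> I" "I - {j} \<noteq> {}"
        using j False by auto
      show "\<exists>i\<in>J. f i z \<ge> 0"
        if "J \<subseteq> I - {j}" "J \<noteq> {}" "z \<in> convex hull (x ` J)" for J z
        using cover that by blast
    qed (use conc cont in auto)
    moreover have "convex hull (x ` (I - {j})) \<subseteq> ?S"
      by (intro hull_mono) auto
    ultimately show ?thesis by blast
  qed
  then obtain y where y: "\<And>j. j \<in> I \<Longrightarrow> y j \<in> ?S"
    "\<And>i j. j \<in> I \<Longrightarrow> i \<in> I \<Longrightarrow> i \<noteq> j \<Longrightarrow> f i (y j) \<ge> 0"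
    by (metis DiffI singletonD)
  \<comment> \<open>Maximising the minimum over the compact hull reduces the claim to the sign of
    one value.\<close>
  define h where "h z = Min ((\<lambda>i. f i z) ` I)" for z
  have h_le: "h z \<le> f i z" if "i \<in> I" for i z
    using that \<open>finite I\<close> by (auto simp: h_def)
  have "continuous_on ?S h"
    unfolding h_def
    by (rule continuous_on_Min_image[OF \<open>finite I\<close> \<open>I \<noteq> {}\<close>])
      (meson cont continuous_on_subset top_greatest)
  moreover have "compact ?S"
    using \<open>finite I\<close> by (intro finite_imp_compact_convex_hull) auto
  moreover have "?S \<noteq> {}"
    using \<open>I \<noteq> {}\<close> by simp
  ultimately obtain z where z: "z \<in> ?S" and z_max: "\<And>w. w \<in> ?S \<Longrightarrow> h w \<le> h z"
    using continuous_attains_sup by metis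
  have "h z \<ge> 0"
  proof (rule ccontr)
    assume neg: "\<not> h z \<ge> 0"
    \<comment> \<open>If every \<open>f k\<close> attains the negative minimum at \<open>z\<close>,
      all of them are negative there, contrary to the covering hypothesis for the full index
      set.\<close>
    have "f k z = h z" if k: "k \<in> I" for k
    proof (rule ccontr)
      assume "f k z \<noteq> h z"
      with h_le[OF k, of z] have gt: "h z < f k z" by simp
      \<comment> \<open>Moving from \<open>z\<close> slightly towards \<open>y k\<close> keeps \<open>f k\<close> above the minimum and strictly
        increases the other functions that attain it.\<close>
      define w where "w s = (1 - s) *\<^sub>R z + s *\<^sub>R y k" for s :: real
      have "isCont (f k) (w 0)"
        using cont[OF k] by (simp add: continuous_on_eq_continuous_at)
      moreover have "(w \<longlongrightarrow> w 0) (at_right 0)"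
        unfolding w_def by (intro tendsto_intros)
      ultimately have "((\<lambda>s. f k (w s)) \<longlongrightarrow> f k (w 0)) (at_right 0)"
        by (rule isCont_tendsto_compose)
      moreover have "h z < f k (w 0)"
        using gt by (simp add: w_def)
      ultimately have "\<forall>\<^sub>F s in at_right 0. h z < f k (w s)"
        by (rule order_tendstoD(1))
      moreover have "\<forall>\<^sub>F s in at_right 0. s \<in> {0<..<1::real}"
        by (rule eventually_at_right_real) simp
      ultimately have "\<forall>\<^sub>F s in at_right 0. h z < f k (w s) \<and> s < 1 \<and> 0 < s"
        by eventually_elim simp
      then obtain s where s: "h z < f k (w s)" "s < 1" "0 < s"
        using eventually_happens trivial_limit_at_right_real by blast
      have "h z < f i (w s)" if i: "i \<in> I" for i
      proof (cases "i = k")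
        case False
        \<comment> \<open>Strict because \<open>h z\<close> is negative and
          \<open>s > 0\<close>.\<close>
        have "h z < (1 - s) * h z"
          using neg s by (simp add: algebra_simps mult_pos_neg)
        also have "\<dots> \<le> (1 - s) * f i z + s * f i (y k)"
          using h_le[OF i, of z] y(2)[OF k i False] s
          by (simp add: add_increasing2 mult_left_mono)
        also have "\<dots> \<le> f i (w s)"
          using concave_onD[OF conc[OF i], of s z "y k"] s by (simp add: w_def)
        finally show ?thesis .
      qed (use s in simp)
      then have "h z < h (w s)"
        using \<open>finite I\<close> \<open>I \<noteq> {}\<close> by (auto simp: h_def)
      moreover have "w s \<in> ?S"
        unfolding w_def using z y(1)[OF k] s by (intro convexD[OF convex_convex_hull]) auto
      ultimately show False
        using z_max by fastforce
    qed
    with cover[OF subset_refl \<open>I \<noteq> {}\<close> z] neg show False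
      by fastforce
  qed
  with z h_le show ?case
    by (meson order_trans)
qed

section \<open>The algebraic interior of a convex set\<close>

lemma algebraic_interior_subset: "algebraic_interior U \<subseteq> U"
  by (auto simp: algebraic_interior_def)

text \<open>The contraction with ratio \<open>1 - s\<close> centred at \<open>y\<close> maps
  \<open>U\<close> into itself and turns a step \<open>t / (1 - s)\<close> from \<open>x\<close>
  into a step \<open>t\<close> from the new point. The admissible length \<open>l\<close> at
  \<open>x\<close> thus becomes \<open>(1 - s) * l\<close>.\<close>

lemma algebraic_interior_segment:
  assumes "convex U" "x \<in> algebraic_interior U" "y \<in> U" "0 \<le> s" "s < 1"
  shows "(1 - s) *\<^sub>R x + s *\<^sub>R y \<in> algebraic_interior U"
proof -
  have xU: "x \<in> U"
    using assms algebraic_interior_subset by blast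
  have "\<exists>l>0. \<forall>t. 0 \<le> t \<and> t < l \<longrightarrow> ((1 - s) *\<^sub>R x + s *\<^sub>R y) + t *\<^sub>R d \<in> U" for d
  proof -
    obtain l where l: "l > 0" "\<And>t. 0 \<le> t \<Longrightarrow> t < l \<Longrightarrow> x + t *\<^sub>R d \<in> U"
      using assms(2) unfolding algebraic_interior_def by blast
    have "((1 - s) *\<^sub>R x + s *\<^sub>R y) + t *\<^sub>R d \<in> U" if t: "0 \<le> t" "t < (1 - s) * l" for t
    proof -
      have "x + (t / (1 - s)) *\<^sub>R d \<in> U"
        using t assms by (intro l) (auto simp: field_simps)
      then have "(1 - s) *\<^sub>R (x + (t / (1 - s)) *\<^sub>R d) + s *\<^sub>R y \<in> U"
        using assms by (intro convexD) auto
      then show ?thesis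
        using assms by (simp add: scaleR_add_right add_ac)
    qed
    then show ?thesis
      using l(1) \<open>s < 1\<close> by (intro exI[of _ "(1 - s) * l"]) auto
  qed
  moreover have "(1 - s) *\<^sub>R x + s *\<^sub>R y \<in> U"
    using assms xU by (intro convexD) auto
  ultimately show ?thesis
    by (simp add: algebraic_interior_def)
qed

lemma convex_algebraic_interior:
  assumes "convex U"
  shows "convex (algebraic_interior U)"
proof (rule convexI)
  fix x y and u v :: real
  assume *: "x \<in> algebraic_interior U" "y \<in> algebraic_interior U" "0 \<le> u" "0 \<le> v" "u + v = 1"
  show "u *\<^sub>R x + v *\<^sub>R y \<in> algebraic_interior U"
  \<comment> \<open>At \<open>v = 1\<close> the point is \<open>y\<close>, the endpoint that the
    segment lemma leaves out.\<close>
  proof (cases "v = 1")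
    case False
    with * have "v < 1" "u = 1 - v" by auto
    with * algebraic_interior_segment[OF assms, of x y v] algebraic_interior_subset[of U]
    show ?thesis by auto
  qed (use * in auto)
qed

text \<open>The point \<open>x + t *\<^sub>R d\<close> is the midpoint of \<open>x\<close> and
  \<open>x + (2 * t) *\<^sub>R d\<close>, and the latter lies in \<open>U\<close> when
  \<open>t < l / 2\<close>.\<close>

lemma eventually_segment_algebraic_interior:
  assumes "convex U" "x \<in> algebraic_interior U"
  shows "\<forall>\<^sub>F t in at_right 0. x + t *\<^sub>R d \<in> algebraic_interior U"
proof -
  obtain l where l: "l > 0" "\<And>t. 0 \<le> t \<Longrightarrow> t < l \<Longrightarrow> x + t *\<^sub>R d \<in> U"
    using assms(2) unfolding algebraic_interior_def by blast
  have "x + t *\<^sub>R d \<in> algebraic_interior U" if t: "0 < t" "t < l / 2" for t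
  proof -
    have "x + (2 * t) *\<^sub>R d \<in> U"
      using t by (intro l) auto
    then have "(1 - 1/2) *\<^sub>R x + (1/2) *\<^sub>R (x + (2 * t) *\<^sub>R d) \<in> algebraic_interior U"
      by (intro algebraic_interior_segment assms) auto
    moreover have "(1 - 1/2) *\<^sub>R x + (1/2) *\<^sub>R (x + (2 * t) *\<^sub>R d) = x + t *\<^sub>R d"
      by (simp add: scaleR_add_right scaleR_add_left[symmetric] add.assoc[symmetric])
    ultimately show ?thesis by simp
  qed
  then show ?thesis
    using l(1) by (auto simp: eventually_at_right_field intro!: exI[of _ "l / 2"])
qed

section \<open>Weak topology and variational inequalities\<close>

text \<open>The weak topology is pulled back from a product topology, where evaluation at the
  coordinate \<open>f\<close> is continuous. Weak compactness can therefore act on Minty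
  inequalities, which are half-space conditions on the solution.\<close>

lemma closedin_weak_topology_halfspace:
  fixes f :: "'a::real_normed_vector \<Rightarrow>\<^sub>L real"
  shows "closedin weak_topology {z. blinfun_apply f z \<le> c}"
proof -
  have "continuous_map euclidean euclidean (\<lambda>g :: ('a \<Rightarrow>\<^sub>L real) \<Rightarrow> real. g f)"
    by (simp add: continuous_map_iff_continuous2 continuous_on_product_coordinates)
  from continuous_map_pullback[OF this]
  have "continuous_map weak_topology euclidean (blinfun_apply f)"
    unfolding weak_topology_def by (simp add: comp_def)
  from closedin_continuous_map_preimage[OF this, of "{..c}"]
  show ?thesis
    by (simp add: weak_topology_def topspace_pullback_topology)
qed

text \<open>Upper sign-continuity is available only on \<open>V\<close>, so \<open>y\<close> is
  replaced by a point \<open>w\<close> of the segment close to \<open>x\<close>. As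
  \<open>w - x\<close> is a positive multiple of \<open>y - x\<close>, the signs agree and the
  factor leaves the supremum.\<close>

lemma radial_Minty_imp_Stampacchia:
  assumes "x \<in> K" "locally_upper_sign_continuous_at T x" "y \<in> K"
    and Minty: "\<forall>\<^sub>F t in at_right 0. \<forall>ys\<in>T (x + t *\<^sub>R (y - x)). blinfun_apply ys (y - x) \<ge> 0"
  shows "(SUP xs \<in> T x. ereal (blinfun_apply xs (y - x))) \<ge> 0"
proof -
  obtain V \<Phi> where "convex V" and x: "x \<in> interior V"
    and usc: "upper_sign_continuous_on V \<Phi>"
    and \<Phi>: "\<And>v. v \<in> V \<Longrightarrow> \<Phi> v \<noteq> {} \<and> \<Phi> v \<subseteq> T v"
    using assms(2) unfolding locally_upper_sign_continuous_at_def by blast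
  have xV: "x \<in> V"
    using x interior_subset by blast
  have "((\<lambda>t. x + t *\<^sub>R (y - x)) \<longlongrightarrow> x + 0 *\<^sub>R (y - x)) (at_right 0)"
    by (intro tendsto_intros)
  with x have "\<forall>\<^sub>F t in at_right 0. x + t *\<^sub>R (y - x) \<in> interior V"
    by (intro topological_tendstoD[where l = x]) auto
  then have "\<forall>\<^sub>F t in at_right 0. x + t *\<^sub>R (y - x) \<in> V \<and>
      (\<forall>ys\<in>T (x + t *\<^sub>R (y - x)). blinfun_apply ys (y - x) \<ge> 0)"
    using Minty by eventually_elim (use interior_subset in blast)
  then obtain b where b: "b > 0"
    "\<And>t. 0 < t \<Longrightarrow> t < b \<Longrightarrow> x + t *\<^sub>R (y - x) \<in> V"
    "\<And>t ys. 0 < t \<Longrightarrow> t < b \<Longrightarrow> ys \<in> T (x + t *\<^sub>R (y - x)) \<Longrightarrow> blinfun_apply ys (y - x) \<ge> 0"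
    unfolding eventually_at_right_field by blast
  define s where "s = b / 2"
  have s: "0 < s" "s < b"
    using b(1) by (auto simp: s_def)
  define w where "w = x + s *\<^sub>R (y - x)"
  have wV: "w \<in> V"
    using b(2) s by (simp add: w_def)
  have "(INF xs \<in> \<Phi> (t *\<^sub>R x + (1 - t) *\<^sub>R w). ereal (blinfun_apply xs (w - x))) \<ge> 0"
    if t: "0 < t" "t < 1" for t
  proof (rule INF_greatest)
    fix xs assume xs: "xs \<in> \<Phi> (t *\<^sub>R x + (1 - t) *\<^sub>R w)"
    \<comment> \<open>The convention puts \<open>x\<close> at \<open>t = 1\<close> and
      \<open>w\<close> at \<open>t = 0\<close>, so the distance parameter from \<open>x\<close> is
      \<open>(1 - t) * s\<close>.\<close>
    have eq: "t *\<^sub>R x + (1 - t) *\<^sub>R w = x + ((1 - t) * s) *\<^sub>R (y - x)"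
      by (simp add: w_def algebra_simps)
    have pos: "0 < (1 - t) * s"
      using t s by simp
    have "(1 - t) * s < 1 * s"
      using t s by (intro mult_strict_right_mono) auto
    then have less: "(1 - t) * s < b"
      using s by linarith
    have "xs \<in> T (x + ((1 - t) * s) *\<^sub>R (y - x))"
      using xs \<Phi>[OF b(2)[OF pos less]] by (auto simp: eq)
    then have "blinfun_apply xs (y - x) \<ge> 0"
      using b(3) pos less by blast
    then show "0 \<le> ereal (blinfun_apply xs (w - x))"
      using s by (simp add: w_def blinfun.scaleR_right)
  qed
  with usc xV wV have "0 \<le> (SUP xs \<in> \<Phi> x. ereal (blinfun_apply xs (w - x)))"
    unfolding upper_sign_continuous_on_def by blast
  also have "\<dots> = ereal s * (SUP xs \<in> \<Phi> x. ereal (blinfun_apply xs (y - x)))"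
    using \<Phi>[OF xV] s by (simp add: Sup_ereal_mult_left' w_def blinfun.scaleR_right)
  finally have "0 \<le> (SUP xs \<in> \<Phi> x. ereal (blinfun_apply xs (y - x)))"
    using s by (simp add: ereal_zero_le_0_iff)
  also have "\<dots> \<le> (SUP xs \<in> T x. ereal (blinfun_apply xs (y - x)))"
    using \<Phi>[OF xV] by (intro SUP_subset_mono) auto
  finally show ?thesis .
qed

text \<open>The violations are finitely many strict inequalities, hence stable near
  \<open>z\<close>. At a nearby \<open>w\<close> they trigger quasimonotonicity from every node to
  \<open>w\<close>, and averaging over the nodes replaces them by \<open>z\<close>.\<close>

lemma not_properly_quasimonotone_imp_radial_Minty:
  fixes P :: "('a::real_normed_vector \<times> ('a \<Rightarrow>\<^sub>L real)) set"
  assumes qm: "quasimonotone_on K T" and "convex K" and "finite P"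
    and P: "\<And>p. p \<in> P \<Longrightarrow> fst p \<in> K \<and> snd p \<in> T (fst p)"
    and z: "z \<in> convex hull (fst ` P)"
    and viol: "\<And>p. p \<in> P \<Longrightarrow> blinfun_apply (snd p) (fst p - z) < 0"
    and "y \<in> K"
  shows "\<forall>\<^sub>F t in at_right 0. \<forall>ys\<in>T (z + t *\<^sub>R (y - z)). blinfun_apply ys (y - z) \<ge> 0"
proof -
  have "z \<in> K"
    using z hull_minimal[of "fst ` P" K convex] P \<open>convex K\<close> by blast
  have "\<forall>\<^sub>F t in at_right 0. blinfun_apply (snd p) (z + t *\<^sub>R (y - z) - fst p) > 0"
    if "p \<in> P" for p
  proof (rule order_tendstoD(1))
    show "((\<lambda>t. blinfun_apply (snd p) (z + t *\<^sub>R (y - z) - fst p)) \<longlongrightarrow>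
        blinfun_apply (snd p) (z + 0 *\<^sub>R (y - z) - fst p)) (at_right 0)"
      by (intro tendsto_intros)
    show "0 < blinfun_apply (snd p) (z + 0 *\<^sub>R (y - z) - fst p)"
      using viol[OF that] by (simp add: blinfun.diff_right)
  qed
  then have "\<forall>\<^sub>F t in at_right 0.
      \<forall>p\<in>P. blinfun_apply (snd p) (z + t *\<^sub>R (y - z) - fst p) > 0"
    using \<open>finite P\<close> by (intro eventually_ball_finite) auto
  moreover have "\<forall>\<^sub>F t in at_right 0. t \<in> {0<..<1::real}"
    by (rule eventually_at_right_real) simp
  ultimately show ?thesis
  proof eventually_elim
    case (elim t)
    define w where "w = z + t *\<^sub>R (y - z)"
    have "(1 - t) *\<^sub>R z + t *\<^sub>R y \<in> K"
      using \<open>convex K\<close> \<open>z \<in> K\<close> \<open>y \<in> K\<close> elim by (intro convexD) auto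
    then have "w \<in> K"
      by (simp add: w_def algebra_simps)
    show ?case
    proof
      fix ys assume ys: "ys \<in> T (z + t *\<^sub>R (y - z))"
      have "blinfun_apply ys (w - fst p) \<ge> 0" if "p \<in> P" for p
        using qm \<open>w \<in> K\<close> P[OF that] elim that ys unfolding quasimonotone_on_def w_def by blast
      \<comment> \<open>A half-space that contains all nodes contains their hull, hence
        \<open>z\<close>.\<close>
      then have "fst ` P \<subseteq> {u. blinfun_apply ys u \<le> blinfun_apply ys w}"
        by (auto simp: blinfun.diff_right)
      moreover have "convex {u. blinfun_apply ys u \<le> blinfun_apply ys w}"
        by (auto simp: convex_def blinfun.add_right blinfun.scaleR_right intro!: convex_bound_le)
      ultimately have "convex hull (fst ` P) \<subseteq> {u. blinfun_apply ys u \<le> blinfun_apply ys w}"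
        by (rule hull_minimal)
      with z have "0 \<le> blinfun_apply ys (w - z)"
        by (auto simp: blinfun.diff_right)
      then show "0 \<le> blinfun_apply ys (y - z)"
        using elim by (simp add: w_def blinfun.scaleR_right zero_le_mult_iff)
    qed
  qed
qed

text \<open>Minty solutions are the common points of \<open>C\<close> and the half-spaces
  \<open>G p\<close> over the graph. These are weakly closed, so by compactness finite intersections
  suffice, and \<open>concave_KKM\<close> for affine functions provides them. Indexing by pairs
  rather than points lets one node carry several functionals.\<close>

lemma properly_quasimonotone_imp_Minty:
  fixes C :: "'a::real_normed_vector set" and T :: "'a \<Rightarrow> ('a \<Rightarrow>\<^sub>L real) set"
  assumes "C \<noteq> {}" "convex C" "compactin weak_topology C"
    and proper: "\<And>J z. finite J \<Longrightarrow> J \<noteq> {} \<Longrightarrow> J \<subseteq> Sigma C T \<Longrightarrow> z \<in> convex hull (fst ` J) \<Longrightarrow>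
      \<exists>p\<in>J. blinfun_apply (snd p) (fst p - z) \<ge> 0"
  shows "\<exists>z\<in>C. \<forall>y\<in>C. \<forall>ys\<in>T y. blinfun_apply ys (y - z) \<ge> 0"
proof -
  define G where "G p = {z. blinfun_apply (snd p) z \<le> blinfun_apply (snd p) (fst p)}"
    for p :: "'a \<times> ('a \<Rightarrow>\<^sub>L real)"
  have "C \<inter> \<Inter> \<F> \<noteq> {}" if "finite \<F>" "\<F> \<subseteq> G ` Sigma C T" for \<F>
  proof -
    obtain J where J: "J \<subseteq> Sigma C T" "finite J" "\<F> = G ` J"
      using finite_subset_image[OF \<open>finite \<F>\<close> \<open>\<F> \<subseteq> _\<close>] by blast
    show ?thesis
    proof (cases "J = {}")
      case True
      with J \<open>C \<noteq> {}\<close> show ?thesis by simp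
    next
      case False
      have "\<exists>z \<in> convex hull (fst ` J). \<forall>p\<in>J. blinfun_apply (snd p) (fst p - z) \<ge> 0"
      proof (rule concave_KKM)
        show "concave_on UNIV (\<lambda>z. blinfun_apply (snd p) (fst p - z))" if "p \<in> J" for p
        proof -
          \<comment> \<open>The constant part of the affine function is preserved by convex
            combinations.\<close>
          have "u * blinfun_apply (snd p) (fst p) + v * blinfun_apply (snd p) (fst p) =
              blinfun_apply (snd p) (fst p)" if "u + v = 1" for u v
            using that by (metis distrib_right mult_1)
          then show ?thesis
            by (auto simp: concave_on_iff blinfun.diff_right blinfun.add_right
                blinfun.scaleR_right right_diff_distrib algebra_simps)
        qed
        show "continuous_on UNIV (\<lambda>z. blinfun_apply (snd p) (fst p - z))" if "p \<in> J" for p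
          by (intro continuous_intros)
        show "\<exists>p\<in>J'. blinfun_apply (snd p) (fst p - z) \<ge> 0"
          if "J' \<subseteq> J" "J' \<noteq> {}" "z \<in> convex hull (fst ` J')" for J' z
          using proper that J by (meson finite_subset order_trans)
      qed (use J False in auto)
      then obtain z where "z \<in> convex hull (fst ` J)"
        and "\<forall>p\<in>J. blinfun_apply (snd p) (fst p - z) \<ge> 0"
        by blast
      moreover have "convex hull (fst ` J) \<subseteq> C"
        using J \<open>convex C\<close> by (intro hull_minimal) auto
      ultimately have "z \<in> C \<inter> \<Inter> \<F>"
        by (auto simp: J G_def blinfun.diff_right)
      then show ?thesis by blast
    qed
  qed
  moreover have "closedin weak_topology S" if "S \<in> G ` Sigma C T" for S
    using that closedin_weak_topology_halfspace by (auto simp: G_def)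
  ultimately have "C \<inter> \<Inter> (G ` Sigma C T) \<noteq> {}"
    using \<open>compactin weak_topology C\<close> unfolding compactin_fip by blast
  then obtain z where "z \<in> C" and "\<And>p. p \<in> Sigma C T \<Longrightarrow> z \<in> G p"
    by blast
  then show ?thesis
    by (intro bexI[of _ z]) (fastforce simp: G_def blinfun.diff_right)+
qed

theorem theorem3p7:
  fixes K U :: "'a::banach set"
    and T :: "'a \<Rightarrow> ('a \<Rightarrow>\<^sub>L real) set"
  assumes "K \<noteq> {}" and "convex K"
    and "U \<noteq> {}" and "convex U"
    and "K \<inter> algebraic_interior U \<noteq> {}"
    and "compactin weak_topology (K \<inter> algebraic_interior U)"
    and "quasimonotone_on K T"
    and "locally_upper_sign_continuous T"
  shows "\<exists>x\<in>K. \<forall>y\<in>K. (SUP xs \<in> T x. ereal (blinfun_apply xs (y - x))) \<ge> 0"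
proof -
  define C where "C = K \<inter> algebraic_interior U"
  have "convex C"
    unfolding C_def by (intro convex_Int convex_algebraic_interior assms)
  have "\<exists>x\<in>K. \<forall>y\<in>K. \<forall>\<^sub>F t in at_right 0.
      \<forall>ys\<in>T (x + t *\<^sub>R (y - x)). blinfun_apply ys (y - x) \<ge> 0"
  proof (cases "\<exists>J z. finite J \<and> J \<subseteq> Sigma C T \<and> z \<in> convex hull (fst ` J) \<and>
      (\<forall>p\<in>J. blinfun_apply (snd p) (fst p - z) < 0)")
    case True
    then obtain J z where J: "finite J" "J \<subseteq> Sigma C T" "z \<in> convex hull (fst ` J)"
      "\<And>p. p \<in> J \<Longrightarrow> blinfun_apply (snd p) (fst p - z) < 0"
      by blast
    have JK: "fst p \<in> K \<and> snd p \<in> T (fst p)" if "p \<in> J" for p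
      using J(2) that by (auto simp: C_def)
    have "z \<in> K"
      using J(3) hull_minimal[of "fst ` J" K convex] JK \<open>convex K\<close> by blast
    then show ?thesis
      using not_properly_quasimonotone_imp_radial_Minty[OF \<open>quasimonotone_on K T\<close>
          \<open>convex K\<close> J(1) JK J(3,4)] by blast
  next
    case False
    have "\<exists>z\<in>C. \<forall>y\<in>C. \<forall>ys\<in>T y. blinfun_apply ys (y - z) \<ge> 0"
    proof (rule properly_quasimonotone_imp_Minty)
      show "\<exists>p\<in>J. blinfun_apply (snd p) (fst p - z) \<ge> 0"
        if "finite J" "J \<subseteq> Sigma C T" "z \<in> convex hull (fst ` J)" for J z
        using False that by (meson not_le)
    qed (use assms \<open>convex C\<close> in \<open>auto simp: C_def\<close>)
    then obtain x where "x \<in> C"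
      and x: "\<And>y ys. y \<in> C \<Longrightarrow> ys \<in> T y \<Longrightarrow> blinfun_apply ys (y - x) \<ge> 0"
      by blast
    \<comment> \<open>Here \<open>y\<close> need not lie in \<open>C\<close>, but for small
      \<open>t\<close> the segment stays in both \<open>K\<close> and the algebraic interior of
      \<open>U\<close>. The inequality over \<open>C\<close> applies there, and the factor
      \<open>t > 0\<close> is divided out.\<close>
    have "\<forall>\<^sub>F t in at_right 0. \<forall>ys\<in>T (x + t *\<^sub>R (y - x)). blinfun_apply ys (y - x) \<ge> 0"
      if "y \<in> K" for y
    proof -
      have "\<forall>\<^sub>F t in at_right 0. x + t *\<^sub>R (y - x) \<in> algebraic_interior U"
        using \<open>x \<in> C\<close> \<open>convex U\<close>
        by (intro eventually_segment_algebraic_interior) (auto simp: C_def)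
      moreover have "\<forall>\<^sub>F t in at_right 0. t \<in> {0<..<1::real}"
        by (rule eventually_at_right_real) simp
      ultimately show ?thesis
      proof eventually_elim
        case (elim t)
        have "(1 - t) *\<^sub>R x + t *\<^sub>R y \<in> K"
          using \<open>convex K\<close> \<open>x \<in> C\<close> \<open>y \<in> K\<close> elim by (intro convexD) (auto simp: C_def)
        then have "x + t *\<^sub>R (y - x) \<in> C"
          using elim by (simp add: C_def algebra_simps)
        from x[OF this] elim show ?case
          by (auto simp: blinfun.scaleR_right zero_le_mult_iff)
      qed
    qed
    with \<open>x \<in> C\<close> show ?thesis
      by (auto simp: C_def)
  qed
  then obtain x where "x \<in> K" and "\<And>y. y \<in> K \<Longrightarrow> \<forall>\<^sub>F t in at_right 0.
      \<forall>ys\<in>T (x + t *\<^sub>R (y - x)). blinfun_apply ys (y - x) \<ge> 0"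
    by blast
  moreover have "locally_upper_sign_continuous_at T x"
    using assms by (simp add: locally_upper_sign_continuous_def)
  ultimately show ?thesis
    using radial_Minty_imp_Stampacchia by blast
qed

end
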